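(* Let $-\infty\le a<b\le\infty$, let $F_0$ be a baseline distribution function on $[a,b]$, let $\theta>0$, and let $(Y_1,Y_2)$ be a random pair with joint distribution function $F(y_1,y_2)$ supported on $[a,b]\times[a,b]$ such that $Y=\max\{Y_1,Y_2\}$ follows the proportional reversed hazards model with baseline $F_0$ and proportionality parameter $\theta$, i.e. $F(y,y)=[F_0(y)]^{\theta}$ for all $y$. Suppose $F(y_1,y_2)=G(F_0(y_1),F_0(y_2))$ for a function $G$ satisfying $G(F_0(y_1),1)=F_{Y_1}(y_1)$, $G(1,F_0(y_2))=F_{Y_2}(y_2)$ and $G(1,1)=1$, where $F_{Y_1},F_{Y_2}$ are the marginal distribution functions of $Y_1,Y_2$. Then $G$ satisfies the functional equation $$G\big(F_0(y)F_0(y_1),\,F_0(y)F_0(y_2)\big)=G\big(F_0(y_1),F_0(y_2)\big)\,G\big(F_0(y),F_0(y)\big)$$ for all $y,y_1,y_2$ with $0<F_0(y),F_0(y_1),F_0(y_2)<1$ if and only if $F$ is of the form $$F(y_1,y_2)=G(F_0(y_1),F_0(y_2))=\begin{cases}[F_0(y_1)]^{\theta}\,G\Big(1,\dfrac{F_0(y_2)}{F_0(y_1)}\Big) & \text{if } y_1\ge y_2,\\[2mm] [F_0(y_2)]^{\theta}\,G\Big(\dfrac{F_0(y_1)}{F_0(y_2)},1\Big) & \text{if } y_1\le y_2,\end{cases}$$ for all $y_1,y_2$ with $F_0(y_1),F_0(y_2)>0$.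
   Context: The baseline distribution function $F_0$ is that of an absolutely continuous random variable whose interval of support is $[a,b]$, with $a=\inf\{y: F_0(y)>0\}$ and $b=\sup\{y: F_0(y)<1\}$; $F_0$ is strictly increasing on $[a,b]$ and takes every value in $(0,1)$. A random variable $Y$ follows the (univariate) proportional reversed hazards model with baseline $F_0$ and parameter $\theta>0$ if its distribution function is $[F_0(y)]^{\theta}$. The function $G$ is defined on $[0,1]\times[0,1]$. The conditions on $G$ express $F(y_1,\infty)=F_{Y_1}(y_1)$, $F(\infty,y_2)=F_{Y_2}(y_2)$ and $F(\infty,\infty)=1$. *)

theory Defs
  imports "HOL-Probability.Probability"
begin

text \<open>The support bounds \<open>a\<close> and \<open>b\<close> are extended reals because the interval of support may
  be unbounded. For a point \<open>y\<close> of the real line, membership in the support is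
  \<open>ereal y \<in> {a..b}\<close>.\<close>

text \<open>\<open>absolutely_continuous lborel M\<^sub>0\<close> says that the law \<open>M\<^sub>0\<close> of the baseline variable is
  absolutely continuous with respect to Lebesgue measure. The last conjunct follows from the
  continuity of \<open>F\<^sub>0\<close>; it is kept as one of the standing properties of a baseline.\<close>

definition baseline_cdf :: "(real \<Rightarrow> real) \<Rightarrow> ereal \<Rightarrow> ereal \<Rightarrow> bool" where
  "baseline_cdf F\<^sub>0 a b \<longleftrightarrow>
     (\<exists>M\<^sub>0. real_distribution M\<^sub>0 \<and> absolutely_continuous lborel M\<^sub>0 \<and> F\<^sub>0 = cdf M\<^sub>0) \<and>
     a = Inf (ereal ` {y. 0 < F\<^sub>0 y}) \<and>
     b = Sup (ereal ` {y. F\<^sub>0 y < 1}) \<and>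
     strict_mono_on {y. ereal y \<in> {a..b}} F\<^sub>0 \<and>
     {0<..<1} \<subseteq> range F\<^sub>0"

definition marginal_cdf :: "'s measure \<Rightarrow> ('s \<Rightarrow> real) \<Rightarrow> real \<Rightarrow> real" where
  "marginal_cdf M X = cdf (distr M borel X)"

definition joint_cdf :: "'s measure \<Rightarrow> ('s \<Rightarrow> real) \<Rightarrow> ('s \<Rightarrow> real) \<Rightarrow> real \<Rightarrow> real \<Rightarrow> real" where
  "joint_cdf M Y\<^sub>1 Y\<^sub>2 y\<^sub>1 y\<^sub>2 = \<P>(\<omega> in M. Y\<^sub>1 \<omega> \<le> y\<^sub>1 \<and> Y\<^sub>2 \<omega> \<le> y\<^sub>2)"

text \<open>Proportional reversed hazards model. Where \<open>F\<^sub>0 y = 0\<close>, \<open>powr\<close> gives the intended value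
  \<open>0\<close>.\<close>

definition follows_prh :: "'s measure \<Rightarrow> ('s \<Rightarrow> real) \<Rightarrow> (real \<Rightarrow> real) \<Rightarrow> real \<Rightarrow> bool" where
  "follows_prh M X F\<^sub>0 \<theta> \<longleftrightarrow> (\<forall>y. marginal_cdf M X y = F\<^sub>0 y powr \<theta>)"

end

theory Submission
  imports Defs
begin

text \<open>Write \<open>u = F\<^sub>0 y\<^sub>1\<close> and \<open>v = F\<^sub>0 y\<^sub>2\<close>. On the diagonal \<open>G s s = s powr \<theta>\<close>, because the law of
  the maximum is prescribed, so the functional equation says that \<open>G\<close> is homogeneous of degree
  \<open>\<theta>\<close> on the open unit square. The claimed form says the same thing with one point moved to the
  edge: for \<open>v \<le> u\<close> it is \<open>G u v = u powr \<theta> * G 1 (v / u)\<close>. That the form implies the equation is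
  immediate, since \<open>v / u\<close> does not change when both coordinates are scaled.

  For the other direction the equation has to be carried from the open square to its edge, which
  needs some continuity of \<open>G\<close>, both at \<open>(1, w)\<close> and at \<open>(u, v)\<close>. A joint distribution function need not be
  continuous, even if its maximum has a continuous law: \<open>Y\<^sub>2\<close> can have an atom at a point that \<open>Y\<^sub>1\<close>
  exceeds. It suffices, however, to move the larger coordinate only. If \<open>Y\<^sub>2 \<le> y\<^sub>2 \<le> y\<close>
  and \<open>y < Y\<^sub>1 \<le> y\<^sub>1\<close>, then the maximum lies in \<open>{y<..y\<^sub>1}\<close>; hence
  \<open>0 \<le> G u v - G t v \<le> u powr \<theta> - t powr \<theta>\<close> whenever \<open>0 < v \<le> t \<le> u\<close> and \<open>t < 1\<close>, including \<open>u = 1\<close>, where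
  \<open>G 1 v\<close> is the marginal (lemma \<open>transform_increment_bounds\<close>). Letting \<open>t\<close> tend to \<open>1\<close>
  in \<open>G (u * t) v = u powr \<theta> * G t (v / u)\<close> then gives the form for
  \<open>v < u < 1\<close> (lemma \<open>homogeneity_extends_to_edge\<close>). For \<open>u = 1\<close> and for \<open>u = v\<close> it is trivial,
  given \<open>G 1 1 = 1\<close>, and the case \<open>u \<le> v\<close> follows by exchanging the two variables.

  Points \<open>y > b\<close> lie outside the region where \<open>F = G(F\<^sub>0, F\<^sub>0)\<close> is given. There \<open>F\<^sub>0 y = 1\<close>, and since
  almost surely neither variable exceeds \<open>b\<close>, the joint distribution function has already
  become a marginal, which the boundary conditions identify with \<open>G 1\<close>.\<close>

section \<open>Homogeneity up to the edge of the unit square\<close>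

text \<open>Put \<open>w = v / u\<close>. For \<open>w \<le> t < 1\<close> the homogeneity \<open>g (u * t) v = u powr \<theta> * g t w\<close> lets one write
  \<open>g u v - u powr \<theta> * g 1 w\<close> as the increment of \<open>g\<close> from \<open>(u * t, v)\<close> to \<open>(u, v)\<close> minus
  \<open>u powr \<theta>\<close> times the increment from \<open>(t, w)\<close> to \<open>(1, w)\<close>. Both terms lie between \<open>0\<close> and
  \<open>u powr \<theta> * (1 - t powr \<theta>)\<close>, which vanishes as \<open>t\<close> tends to \<open>1\<close>.\<close>

lemma homogeneity_extends_to_edge:
  fixes g :: "real \<Rightarrow> real \<Rightarrow> real"
  assumes hom: "\<And>s t w. s \<in> {0<..<1} \<Longrightarrow> t \<in> {0<..<1} \<Longrightarrow> w \<in> {0<..<1} \<Longrightarrow>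
      g (s * t) (s * w) = s powr \<theta> * g t w"
    and incr: "\<And>u t v. 0 < v \<Longrightarrow> v \<le> t \<Longrightarrow> t < 1 \<Longrightarrow> t \<le> u \<Longrightarrow> u \<le> 1 \<Longrightarrow>
      0 \<le> g u v - g t v \<and> g u v - g t v \<le> u powr \<theta> - t powr \<theta>"
    and "0 < v" "v < u" "u < 1"
  shows "g u v = u powr \<theta> * g 1 (v / u)"
proof -
  define w where "w = v / u"
  have w: "0 < w" "w < 1" and v: "v = u * w"
    using assms(3-5) by (auto simp: w_def field_simps)
  have bound: "\<bar>g u v - u powr \<theta> * g 1 w\<bar> \<le> u powr \<theta> * (1 - t powr \<theta>)"
    if t: "w \<le> t" "t < 1" for t
  proof -
    have t0: "0 < t" using t w by linarith
    have "g (u * t) v = u powr \<theta> * g t w"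
      unfolding v using assms(3-5) t t0 w by (intro hom) auto
    then have eq: "g u v - u powr \<theta> * g 1 w
        = (g u v - g (u * t) v) - u powr \<theta> * (g 1 w - g t w)"
      by (simp add: algebra_simps)
    have "v \<le> u * t" using t assms(3-5) by (simp add: v mult_left_mono)
    moreover have ut: "u * t < u" using assms(3-5) t by simp
    ultimately have 1: "0 \<le> g u v - g (u * t) v"
        "g u v - g (u * t) v \<le> u powr \<theta> - (u * t) powr \<theta>"
      using incr[of v "u * t" u] assms(3-5) by auto
    have "(u * t) powr \<theta> = u powr \<theta> * t powr \<theta>"
      using assms(3-5) t0 by (simp add: powr_mult)
    then have 2: "g u v - g (u * t) v \<le> u powr \<theta> * (1 - t powr \<theta>)"
      using 1 by (simp add: algebra_simps)
    have 3: "0 \<le> g 1 w - g t w" "g 1 w - g t w \<le> 1 - t powr \<theta>"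
      using incr[of w t 1] w t by auto
    have "0 \<le> u powr \<theta> * (g 1 w - g t w)"
         "u powr \<theta> * (g 1 w - g t w) \<le> u powr \<theta> * (1 - t powr \<theta>)"
      using 3 by (auto intro!: mult_nonneg_nonneg mult_left_mono)
    with 1(1) 2 show ?thesis unfolding eq by linarith
  qed
  have "((\<lambda>t. u powr \<theta> * (1 - t powr \<theta>)) \<longlongrightarrow> u powr \<theta> * (1 - 1 powr \<theta>)) (at_left 1)"
    by (intro tendsto_intros) auto
  moreover have "eventually (\<lambda>t. \<bar>g u v - u powr \<theta> * g 1 w\<bar> \<le> u powr \<theta> * (1 - t powr \<theta>)) (at_left 1)"
    using eventually_at_left_real[OF w(2)] by eventually_elim (auto intro!: bound)
  ultimately have "\<bar>g u v - u powr \<theta> * g 1 w\<bar> \<le> u powr \<theta> * (1 - 1 powr \<theta>)"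
    by (rule tendsto_lowerbound) simp
  then show ?thesis by (simp add: w_def)
qed

section \<open>Joint distribution functions and the maximum\<close>

lemma joint_cdf_swap: "joint_cdf M X Y x y = joint_cdf M Y X y x"
  by (simp add: joint_cdf_def conj_commute)

lemma marginal_cdf_eq_prob:
  assumes "X \<in> borel_measurable M"
  shows "marginal_cdf M X x = \<P>(\<omega> in M. X \<omega> \<le> x)"
  using assms unfolding marginal_cdf_def cdf_def
  by (subst measure_distr) (auto intro!: arg_cong[where f="measure M"])

lemma marginal_cdf_max:
  fixes X Y :: "'s \<Rightarrow> real"
  assumes "X \<in> borel_measurable M" "Y \<in> borel_measurable M"
  shows "marginal_cdf M (\<lambda>\<omega>. max (X \<omega>) (Y \<omega>)) y = joint_cdf M X Y y y"
  using assms by (subst marginal_cdf_eq_prob) (auto simp: joint_cdf_def)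

lemma (in finite_measure) measure_increment_mono:
  assumes "A \<in> sets M" "B \<in> sets M" "C \<in> sets M" "D \<in> sets M"
    and "A \<subseteq> B" "C \<subseteq> D" "B - A \<subseteq> D - C"
  shows "measure M B - measure M A \<le> measure M D - measure M C"
proof -
  have "measure M (B - A) \<le> measure M (D - C)"
    using assms by (intro finite_measure_mono) auto
  then show ?thesis using assms by (simp add: finite_measure_Diff)
qed

text \<open>If \<open>Y \<le> y\<close> and \<open>y \<le> x' < X\<close>, then \<open>X\<close> is the maximum of the pair, so mass gained by raising
  the first argument from \<open>x'\<close> to \<open>x\<close> is also gained on the diagonal. The diagonal values are the
  distribution function of the maximum.\<close>

lemma joint_cdf_increment_bounds:
  fixes X Y :: "'s \<Rightarrow> real"
  assumes "prob_space M"
    and [measurable]: "X \<in> borel_measurable M" "Y \<in> borel_measurable M"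
    and "y \<le> x'" "x' \<le> x"
  shows "0 \<le> joint_cdf M X Y x y - joint_cdf M X Y x' y"
    and "joint_cdf M X Y x y - joint_cdf M X Y x' y \<le> joint_cdf M X Y x x - joint_cdf M X Y x' x'"
proof -
  interpret prob_space M by fact
  have "joint_cdf M X Y x' y \<le> joint_cdf M X Y x y"
    unfolding joint_cdf_def using assms(4,5) by (intro finite_measure_mono) auto
  then show "0 \<le> joint_cdf M X Y x y - joint_cdf M X Y x' y" by simp
  show "joint_cdf M X Y x y - joint_cdf M X Y x' y \<le> joint_cdf M X Y x x - joint_cdf M X Y x' x'"
    unfolding joint_cdf_def using assms(4,5) by (intro measure_increment_mono) auto
qed

text \<open>The limiting case in which the upper end of the first argument is infinite.\<close>

lemma marginal_cdf_increment_bounds: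
  fixes X Y :: "'s \<Rightarrow> real"
  assumes "prob_space M"
    and [measurable]: "X \<in> borel_measurable M" "Y \<in> borel_measurable M"
    and "y \<le> x"
  shows "0 \<le> marginal_cdf M Y y - joint_cdf M X Y x y"
    and "marginal_cdf M Y y - joint_cdf M X Y x y \<le> 1 - joint_cdf M X Y x x"
proof -
  interpret prob_space M by fact
  have "joint_cdf M X Y x y \<le> \<P>(\<omega> in M. Y \<omega> \<le> y)"
    unfolding joint_cdf_def by (intro finite_measure_mono) auto
  then show "0 \<le> marginal_cdf M Y y - joint_cdf M X Y x y"
    by (simp add: marginal_cdf_eq_prob)
  have "\<P>(\<omega> in M. Y \<omega> \<le> y) - joint_cdf M X Y x y \<le> measure M (space M) - joint_cdf M X Y x x"
    unfolding joint_cdf_def using assms(4) by (intro measure_increment_mono) auto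
  then show "marginal_cdf M Y y - joint_cdf M X Y x y \<le> 1 - joint_cdf M X Y x x"
    by (simp add: marginal_cdf_eq_prob prob_space)
qed

lemma joint_cdf_eq_marginal_beyond_support:
  fixes X Y :: "'s \<Rightarrow> real"
  assumes "X \<in> borel_measurable M" "Y \<in> borel_measurable M"
    and "AE \<omega> in M. X \<omega> \<le> x"
  shows "joint_cdf M X Y x y = marginal_cdf M Y y"
  unfolding joint_cdf_def marginal_cdf_eq_prob[OF assms(2)]
  using assms by (intro measure_eq_AE) auto

section \<open>Passing to the unit square\<close>

text \<open>The two cases \<open>u < 1\<close> and \<open>u = 1\<close> are treated apart because the value \<open>1\<close> need not
  be attained by \<open>f\<close> on \<open>S\<close>; there \<open>G 1 v\<close> is the marginal of \<open>Y\<close>.\<close>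

lemma transform_increment_bounds:
  fixes X Y :: "'s \<Rightarrow> real" and f :: "real \<Rightarrow> real"
  assumes "prob_space M" "X \<in> borel_measurable M" "Y \<in> borel_measurable M"
    and mono: "strict_mono_on S f" and range: "{0<..<1} \<subseteq> f ` S"
    and joint: "\<And>x y. x \<in> S \<Longrightarrow> y \<in> S \<Longrightarrow> joint_cdf M X Y x y = G (f x) (f y)"
    and marg: "\<And>y. y \<in> S \<Longrightarrow> G 1 (f y) = marginal_cdf M Y y"
    and diag: "\<And>y. joint_cdf M X Y y y = f y powr \<theta>"
    and "0 < v" "v \<le> t" "t < 1" "t \<le> u" "u \<le> 1"
  shows "0 \<le> G u v - G t v \<and> G u v - G t v \<le> u powr \<theta> - t powr \<theta>"
proof -
  have "v \<in> {0<..<1}" "t \<in> {0<..<1}" using assms(9-13) by auto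
  then obtain y x' where y: "y \<in> S" "v = f y" and x': "x' \<in> S" "t = f x'"
    using range by blast
  have le: "y \<le> x'"
    using strict_mono_on_less_eq[OF mono y(1) x'(1)] assms(10) y x' by simp
  show ?thesis
  proof (cases "u = 1")
    case True
    show ?thesis
      using marginal_cdf_increment_bounds[OF assms(1-3) le] joint[OF x'(1) y(1)] marg[OF y(1)] diag[of x']
      by (simp add: True y(2) x'(2))
  next
    case False
    then have "u \<in> {0<..<1}" using assms(9-13) by auto
    then obtain x where x: "x \<in> S" "u = f x" using range by blast
    have le2: "x' \<le> x"
      using strict_mono_on_less_eq[OF mono x'(1) x(1)] assms(12) x x' by simp
    show ?thesis
      using joint_cdf_increment_bounds[OF assms(1-3) le le2] joint[OF x'(1) y(1)]
        joint[OF x(1) y(1)] diag[of x'] diag[of x]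
      by (simp add: x(2) y(2) x'(2))
  qed
qed

lemma baseline_cdf_mono: "baseline_cdf f a b \<Longrightarrow> mono f"
  unfolding baseline_cdf_def mono_def
  by (metis finite_borel_measure.cdf_nondecreasing real_distribution.finite_borel_measure_M)

lemma baseline_cdf_le_1: "baseline_cdf f a b \<Longrightarrow> f y \<le> 1"
  unfolding baseline_cdf_def
  by (metis real_distribution.cdf_bounded_prob)

lemma baseline_cdf_pos_imp_ge:
  assumes "baseline_cdf f a b" "0 < f y"
  shows "a \<le> ereal y"
  using assms by (auto simp: baseline_cdf_def intro!: Inf_lower)

lemma baseline_cdf_less_1_imp_le:
  assumes "baseline_cdf f a b" "f y < 1"
  shows "ereal y \<le> b"
  using assms by (auto simp: baseline_cdf_def intro!: Sup_upper)

theorem theorem2p1: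
  fixes M :: "'s measure"
    and Y\<^sub>1 Y\<^sub>2 :: "'s \<Rightarrow> real"
    and F\<^sub>0 :: "real \<Rightarrow> real"
    and F G :: "real \<Rightarrow> real \<Rightarrow> real"
    and a b :: ereal
    and \<theta> :: real
  assumes "a < b"
    and "baseline_cdf F\<^sub>0 a b"
    and "0 < \<theta>"
    and "prob_space M"
    and "Y\<^sub>1 \<in> borel_measurable M"
    and "Y\<^sub>2 \<in> borel_measurable M"
    and "AE \<omega> in M. ereal (Y\<^sub>1 \<omega>) \<in> {a..b} \<and> ereal (Y\<^sub>2 \<omega>) \<in> {a..b}"
    and "F = joint_cdf M Y\<^sub>1 Y\<^sub>2"
    and "follows_prh M (\<lambda>\<omega>. max (Y\<^sub>1 \<omega>) (Y\<^sub>2 \<omega>)) F\<^sub>0 \<theta>"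
    and "\<And>y\<^sub>1 y\<^sub>2. ereal y\<^sub>1 \<in> {a..b} \<Longrightarrow> ereal y\<^sub>2 \<in> {a..b} \<Longrightarrow> F y\<^sub>1 y\<^sub>2 = G (F\<^sub>0 y\<^sub>1) (F\<^sub>0 y\<^sub>2)"
    and "\<And>y\<^sub>1. ereal y\<^sub>1 \<in> {a..b} \<Longrightarrow> G (F\<^sub>0 y\<^sub>1) 1 = marginal_cdf M Y\<^sub>1 y\<^sub>1"
    and "\<And>y\<^sub>2. ereal y\<^sub>2 \<in> {a..b} \<Longrightarrow> G 1 (F\<^sub>0 y\<^sub>2) = marginal_cdf M Y\<^sub>2 y\<^sub>2"
    and "G 1 1 = 1"
  shows "(\<forall>y y\<^sub>1 y\<^sub>2. F\<^sub>0 y \<in> {0<..<1} \<and> F\<^sub>0 y\<^sub>1 \<in> {0<..<1} \<and> F\<^sub>0 y\<^sub>2 \<in> {0<..<1} \<longrightarrow>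
            G (F\<^sub>0 y * F\<^sub>0 y\<^sub>1) (F\<^sub>0 y * F\<^sub>0 y\<^sub>2) = G (F\<^sub>0 y\<^sub>1) (F\<^sub>0 y\<^sub>2) * G (F\<^sub>0 y) (F\<^sub>0 y))
    \<longleftrightarrow>
         (\<forall>y\<^sub>1 y\<^sub>2. 0 < F\<^sub>0 y\<^sub>1 \<and> 0 < F\<^sub>0 y\<^sub>2 \<longrightarrow>
            F y\<^sub>1 y\<^sub>2 = G (F\<^sub>0 y\<^sub>1) (F\<^sub>0 y\<^sub>2) \<and>
            (y\<^sub>1 \<ge> y\<^sub>2 \<longrightarrow> F y\<^sub>1 y\<^sub>2 = F\<^sub>0 y\<^sub>1 powr \<theta> * G 1 (F\<^sub>0 y\<^sub>2 / F\<^sub>0 y\<^sub>1)) \<and>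
            (y\<^sub>1 \<le> y\<^sub>2 \<longrightarrow> F y\<^sub>1 y\<^sub>2 = F\<^sub>0 y\<^sub>2 powr \<theta> * G (F\<^sub>0 y\<^sub>1 / F\<^sub>0 y\<^sub>2) 1))"
proof -
  note base = assms(2)
  note meas = assms(5) assms(6)
  define S where "S = {y. ereal y \<in> {a..b}}"
  have mono: "mono F\<^sub>0" and le1: "F\<^sub>0 y \<le> 1" for y
    using baseline_cdf_mono[OF base] baseline_cdf_le_1[OF base] by auto
  have smono: "strict_mono_on S F\<^sub>0" and range: "{0<..<1} \<subseteq> range F\<^sub>0"
    using base by (auto simp: baseline_cdf_def S_def)
  have inS: "y \<in> S" if "0 < F\<^sub>0 y" "F\<^sub>0 y < 1" for y
    using that baseline_cdf_pos_imp_ge[OF base] baseline_cdf_less_1_imp_le[OF base]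
    by (auto simp: S_def)
  have onto: "\<exists>y\<in>S. F\<^sub>0 y = t" if "t \<in> {0<..<1}" for t
  proof -
    obtain y where "F\<^sub>0 y = t" using \<open>t \<in> {0<..<1}\<close> range by blast
    with \<open>t \<in> {0<..<1}\<close> inS[of y] show ?thesis by auto
  qed
  then have rangeS: "{0<..<1} \<subseteq> F\<^sub>0 ` S" by blast
  have diag: "F y y = F\<^sub>0 y powr \<theta>" for y
    using assms(9) marginal_cdf_max[OF meas] unfolding follows_prh_def assms(8) by simp
  have Gdiag: "G t t = t powr \<theta>" if "t \<in> {0<..<1}" for t
    using onto[OF that] assms(10) diag by (fastforce simp: S_def)
  have beyond: "F\<^sub>0 y = 1" "AE \<omega> in M. Y\<^sub>1 \<omega> \<le> y" "AE \<omega> in M. Y\<^sub>2 \<omega> \<le> y"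
    if "0 < F\<^sub>0 y" "y \<notin> S" for y
  proof -
    have y: "b < ereal y" using that baseline_cdf_pos_imp_ge[OF base] by (auto simp: S_def)
    show "F\<^sub>0 y = 1" using that inS le1[of y] by force
    show "AE \<omega> in M. Y\<^sub>1 \<omega> \<le> y" "AE \<omega> in M. Y\<^sub>2 \<omega> \<le> y"
      using assms(7) by (eventually_elim, use y in \<open>force dest: order.strict_trans1\<close>)+
  qed
  have FG: "F y\<^sub>1 y\<^sub>2 = G (F\<^sub>0 y\<^sub>1) (F\<^sub>0 y\<^sub>2)" if pos: "0 < F\<^sub>0 y\<^sub>1" "0 < F\<^sub>0 y\<^sub>2" for y\<^sub>1 y\<^sub>2
  proof (cases "y\<^sub>1 \<in> S")
    case y1: True
    show ?thesis
    proof (cases "y\<^sub>2 \<in> S")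
      case True
      with y1 show ?thesis using assms(10) by (auto simp: S_def)
    next
      case False
      have "F y\<^sub>1 y\<^sub>2 = marginal_cdf M Y\<^sub>1 y\<^sub>1"
        unfolding assms(8) joint_cdf_swap[of M Y\<^sub>1]
        by (rule joint_cdf_eq_marginal_beyond_support[OF meas(2,1) beyond(3)[OF pos(2) False]])
      then show ?thesis using y1 assms(11) beyond(1)[OF pos(2) False] by (simp add: S_def)
    qed
  next
    case y1: False
    have F: "F y\<^sub>1 y\<^sub>2 = marginal_cdf M Y\<^sub>2 y\<^sub>2"
      unfolding assms(8)
      by (rule joint_cdf_eq_marginal_beyond_support[OF meas beyond(2)[OF pos(1) y1]])
    show ?thesis
    proof (cases "y\<^sub>2 \<in> S")
      case True
      then show ?thesis using F assms(12) beyond(1)[OF pos(1) y1] by (simp add: S_def)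
    next
      case False
      interpret prob_space M by fact
      have "marginal_cdf M Y\<^sub>2 y\<^sub>2 = 1"
        unfolding marginal_cdf_eq_prob[OF meas(2)] using beyond(3)[OF pos(2) False] meas
        by (subst prob_Collect_eq_1) auto
      then show ?thesis
        using F beyond(1)[OF pos(1) y1] beyond(1)[OF pos(2) False] assms(13) by simp
    qed
  qed
  have incr1: "0 \<le> G u v - G t v \<and> G u v - G t v \<le> u powr \<theta> - t powr \<theta>"
    if "0 < v" "v \<le> t" "t < 1" "t \<le> u" "u \<le> 1" for u t v
    using assms(4) meas smono rangeS _ _ _ that
    by (rule transform_increment_bounds) (use assms(8,10,12) diag in \<open>auto simp: S_def\<close>)
  have incr2: "0 \<le> G v u - G v t \<and> G v u - G v t \<le> u powr \<theta> - t powr \<theta>"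
    if "0 < v" "v \<le> t" "t < 1" "t \<le> u" "u \<le> 1" for u t v
    using assms(4) meas(2,1) smono rangeS _ _ _ that
    by (rule transform_increment_bounds[where G = "\<lambda>x y. G y x"])
      (use assms(8,10,11) diag in \<open>auto simp: S_def joint_cdf_swap[of M Y\<^sub>2]\<close>)

  show ?thesis (is "?eqn \<longleftrightarrow> ?form")
  proof
    assume eqn: ?eqn
    have hom: "G (s * t) (s * w) = s powr \<theta> * G t w"
      if stw: "s \<in> {0<..<1}" "t \<in> {0<..<1}" "w \<in> {0<..<1}" for s t w
    proof -
      obtain y y1 y2 where "F\<^sub>0 y = s" "F\<^sub>0 y1 = t" "F\<^sub>0 y2 = w"
        using onto[OF stw(1)] onto[OF stw(2)] onto[OF stw(3)] by blast
      with eqn stw have "G (s * t) (s * w) = G t w * G s s" by blast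
      then show ?thesis by (simp add: Gdiag[OF stw(1)])
    qed
    have edge1: "G u v = u powr \<theta> * G 1 (v / u)" if "0 < v" "v \<le> u" "u \<le> 1" for u v
    proof (cases "u = 1 \<or> v = u")
      case True
      then show ?thesis using that Gdiag[of u] assms(13) by (cases "u = 1") auto
    next
      case False
      then show ?thesis
        using that by (intro homogeneity_extends_to_edge[OF hom incr1]) auto
    qed
    have edge2: "G v u = u powr \<theta> * G (v / u) 1" if "0 < v" "v \<le> u" "u \<le> 1" for u v
    proof (cases "u = 1 \<or> v = u")
      case True
      then show ?thesis using that Gdiag[of u] assms(13) by (cases "u = 1") auto
    next
      case False
      then show ?thesis
        using that homogeneity_extends_to_edge[where g = "\<lambda>x y. G y x", OF hom incr2, of v u] by auto
    qed
    show ?form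
    proof (intro allI impI conjI)
      fix y\<^sub>1 y\<^sub>2 assume "0 < F\<^sub>0 y\<^sub>1 \<and> 0 < F\<^sub>0 y\<^sub>2"
      then have pos: "0 < F\<^sub>0 y\<^sub>1" "0 < F\<^sub>0 y\<^sub>2" by auto
      show "F y\<^sub>1 y\<^sub>2 = G (F\<^sub>0 y\<^sub>1) (F\<^sub>0 y\<^sub>2)" by (rule FG[OF pos])
      show "F y\<^sub>1 y\<^sub>2 = F\<^sub>0 y\<^sub>1 powr \<theta> * G 1 (F\<^sub>0 y\<^sub>2 / F\<^sub>0 y\<^sub>1)" if "y\<^sub>2 \<le> y\<^sub>1"
        unfolding FG[OF pos] by (rule edge1[OF pos(2) monoD[OF mono that] le1])
      show "F y\<^sub>1 y\<^sub>2 = F\<^sub>0 y\<^sub>2 powr \<theta> * G (F\<^sub>0 y\<^sub>1 / F\<^sub>0 y\<^sub>2) 1" if "y\<^sub>1 \<le> y\<^sub>2"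
        unfolding FG[OF pos] by (rule edge2[OF pos(1) monoD[OF mono that] le1])
    qed
  next
    assume form: ?form
    \<comment> \<open>The form compares the points \<open>y\<^sub>1\<close> and \<open>y\<^sub>2\<close>, not their values; strict monotonicity on the
      support makes the two orders agree, also for equal values.\<close>
    have edge1: "G u v = u powr \<theta> * G 1 (v / u)" if uv: "u \<in> {0<..<1}" "v \<in> {0<..<1}" "v \<le> u" for u v
    proof -
      obtain y1 y2 where y: "y1 \<in> S" "F\<^sub>0 y1 = u" "y2 \<in> S" "F\<^sub>0 y2 = v"
        using onto[OF uv(1)] onto[OF uv(2)] by blast
      then have "y2 \<le> y1" using strict_mono_on_less_eq[OF smono, of y2 y1] uv by simp
      then show ?thesis using form[rule_format, of y1 y2] y uv by auto
    qed
    have edge2: "G u v = v powr \<theta> * G (u / v) 1" if uv: "u \<in> {0<..<1}" "v \<in> {0<..<1}" "u \<le> v" for u v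
    proof -
      obtain y1 y2 where y: "y1 \<in> S" "F\<^sub>0 y1 = u" "y2 \<in> S" "F\<^sub>0 y2 = v"
        using onto[OF uv(1)] onto[OF uv(2)] by blast
      then have "y1 \<le> y2" using strict_mono_on_less_eq[OF smono, of y1 y2] uv by simp
      then show ?thesis using form[rule_format, of y1 y2] y uv by auto
    qed
    have "G (s * u) (s * v) = G u v * G s s"
      if s: "s \<in> {0<..<1}" and u: "u \<in> {0<..<1}" and v: "v \<in> {0<..<1}" for s u v
    proof -
      have su: "s * u \<in> {0<..<1}" and sv: "s * v \<in> {0<..<1}"
        using s u v mult_strict_mono[of s 1 u 1] mult_strict_mono[of s 1 v 1] by auto
      show ?thesis
      proof (cases "v \<le> u")
        case True
        then have "s * v \<le> s * u" using s by simp
        from edge1[OF su sv this] edge1[OF u v True] show ?thesis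
          using s u by (simp add: Gdiag[OF s] powr_mult)
      next
        case False
        then have "u \<le> v" "s * u \<le> s * v" using s by simp_all
        from edge2[OF su sv this(2)] edge2[OF u v this(1)] show ?thesis
          using s v by (simp add: Gdiag[OF s] powr_mult)
      qed
    qed
    then show ?eqn by blast
  qed
qed

end
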